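(* Let $\tau\in\mathbb{R}_{\ge0}^{|E|T}$ and $B\in\mathbb{R}_{\ge0}^{|G^E|}$. If a feasible flow $\bar y\in\mathcal{Y}^C(\tau,B)$ (together with its lane flows) is a minimizer of the convex program $$\min_{y\in\mathcal{Y}^C(\tau,B),\,x\in\mathbb{R}^{2|E|T}}\ \sum_{t\in[T]}\sum_{e\in E}\Big[\sum_{k=1}^2\int_0^{x_{e,k,t}}\ell_e(w)\,dw+\sum_{g\in G_e^I}\frac{y_{e,1,t}^g\tau_{e,t}}{v_t^g}\Big]\quad\text{s.t. }x_{e,k,t}=\sum_{g\in G_e}y_{e,k,t}^g\ \ \forall e\in E,k\in[2],t\in[T],$$ then $\bar y$ is an $\epsilon$-$(\tau,B)$-CBCP equilibrium, where $$\epsilon:=\delta_v\,T\cdot\max_{g\in G^E}\Big\{d^g\sum_{e\in E:\,g\in G_e^E}\ell_e(d_e)\Big\},\qquad \delta_v:=\frac12\max_{g\in G^E}\Big(\max_{t\in[T]}v_t^g-\min_{t\in[T]}v_t^g\Big).$$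
   Context: Network. $(I,E)$ is a finite acyclic directed graph; $E_i^{\mathrm{in}},E_i^{\mathrm{out}}$ are the edges entering/leaving node $i$. Each edge has two lanes $k\in[2]=\{1,2\}$: an express lane ($k=1$, may be tolled) and a toll-free general-purpose lane ($k=2$). Both lanes of $e$ have the same latency function $\ell_e:\mathbb{R}\to\mathbb{R}$, strictly increasing, convex, nonnegative on $\mathbb{R}_{\ge0}$. Periods are $t\in[T]=\{1,\dots,T\}$. Users. $G=G^E\sqcup G^I$ is a finite set of groups, eligible ($G^E$) or ineligible ($G^I$). Group $g$ has an origin $p_o^g$ and destination $p_d^g$ joined by at least one directed route, a demand $d^g\ge0$, and values of time $v_t^g>0$, $t\in[T]$. $G_e$ is the set of groups having a route from $p_o^g$ to $p_d^g$ containing $e$; $G_e^E=G_e\cap G^E$, $G_e^I=G_e\cap G^I$; $d_e=\sum_{g\in G_e}d^g$; $n=\sum_{e}|G_e|$. Flows. A flow is $y=(y_{e,k,t}^g: e\in E,k\in[2],t\in[T],g\in G_e)\in\mathbb{R}_{\ge0}^{2nT}$; $\mathcal{Y}_{\mathrm{adm}}$ is the set of flows such that for all $i\in I,g\in G,t\in[T]$: $d^g\mathbf 1\{i=p_o^g\}+\sum_{e\in E_i^{\mathrm{in}}}\sum_{k}y_{e,k,t}^g=d^g\mathbf 1\{i=p_d^g\}+\sum_{e\in E_i^{\mathrm{out}}}\sum_{k}y_{e,k,t}^g$ (sums over edges with $g\in G_e$). Lane flows: $x_{e,k,t}=\sum_{g\in G_e}y_{e,k,t}^g$. CBCP (credit-based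 congestion pricing). A policy is $(\tau,B)$ with tolls $\tau\in\mathbb{R}_{\ge0}^{|E|T}$ and budgets $B\in\mathbb{R}_{\ge0}^{|G^E|}$. The feasible set is $\mathcal{Y}^C(\tau,B)=\{y\in\mathcal{Y}_{\mathrm{adm}}:\sum_{t}\sum_{e}y_{e,1,t}^g\tau_{e,t}\le B^g\ \forall g\in G^E\}$. The cost $c_{e,k,t}^g(y)$ is $v_t^g\ell_e(x_{e,1,t})+\tau_{e,t}$ if $k=1,g\in G^I$, and $v_t^g\ell_e(x_{e,k,t})$ otherwise. A flow $y^\star\in\mathcal{Y}^C(\tau,B)$ is an $\epsilon$-$(\tau,B)$-CBCP equilibrium if for each $g\in G$ and every $y\in\mathcal{Y}^C(\tau,B)$: $\sum_{e,k,t}(y_{e,k,t}^g-y_{e,k,t}^{g\star})c_{e,k,t}^g(y^\star)\ge-\epsilon$. *)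

theory Defs
  imports "HOL-Analysis.Analysis" "Graph_Theory.Digraph" "Graph_Theory.Arc_Walk"
begin

section \<open>Networks with express lanes and user groups\<close>

record ('i, 'e, 'g) network =
  net :: "('i, 'e) pre_digraph"
  latency :: "'e \<Rightarrow> real \<Rightarrow> real"
  horizon :: nat
  eligible :: "'g set"
  ineligible :: "'g set"
  orig :: "'g \<Rightarrow> 'i"
  dest :: "'g \<Rightarrow> 'i"
  demand :: "'g \<Rightarrow> real"
  vot :: "'g \<Rightarrow> nat \<Rightarrow> real"

definition groups :: "('i, 'e, 'g) network \<Rightarrow> 'g set" where
  "groups N = eligible N \<union> ineligible N"

definition periods :: "('i, 'e, 'g) network \<Rightarrow> nat set" where
  "periods N = {1..horizon N}"

text \<open>Lane \<open>1\<close> is the express lane, lane \<open>2\<close> the general-purpose lane.\<close>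

definition lanes :: "nat set" where
  "lanes = {1, 2}"

definition groups_on :: "('i, 'e, 'g) network \<Rightarrow> 'e \<Rightarrow> 'g set" where
  "groups_on N e =
     {g \<in> groups N. \<exists>p. pre_digraph.awalk (net N) (orig N g) p (dest N g) \<and> e \<in> set p}"

definition edges_of :: "('i, 'e, 'g) network \<Rightarrow> 'g \<Rightarrow> 'e set" where
  "edges_of N g = {e \<in> arcs (net N). g \<in> groups_on N e}"

definition edge_demand :: "('i, 'e, 'g) network \<Rightarrow> 'e \<Rightarrow> real" where
  "edge_demand N e = (\<Sum>g\<in>groups_on N e. demand N g)"

text \<open>The latency functions are only constrained on the nonnegative half-line, where lane flows
  live; their values at negative arguments are irrelevant. Parallel edges are permitted.\<close>

locale cbcp_network =
  fixes N :: "('i, 'e, 'g) network"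
  assumes finite_digraph: "fin_digraph (net N)"
    and acyclic: "\<nexists>c. pre_digraph.cycle (net N) c"
    and latency_strict_mono: "e \<in> arcs (net N) \<Longrightarrow> strict_mono_on {0..} (latency N e)"
    and latency_convex: "e \<in> arcs (net N) \<Longrightarrow> convex_on {0..} (latency N e)"
    and latency_nonneg: "e \<in> arcs (net N) \<Longrightarrow> 0 \<le> w \<Longrightarrow> 0 \<le> latency N e w"
    and finite_groups: "finite (groups N)"
    and eligibility_disjoint: "eligible N \<inter> ineligible N = {}"
    and route_exists: "g \<in> groups N \<Longrightarrow> \<exists>p. pre_digraph.awalk (net N) (orig N g) p (dest N g)"
    and demand_nonneg: "g \<in> groups N \<Longrightarrow> 0 \<le> demand N g"
    and vot_pos: "g \<in> groups N \<Longrightarrow> t \<in> periods N \<Longrightarrow> 0 < vot N g t"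


section \<open>Flows\<close>

text \<open>A flow \<open>y\<close> has components \<open>y e k t g\<close> for edges \<open>e\<close>, lanes \<open>k\<close>, periods \<open>t\<close> and
  \<open>g \<in> groups_on N e\<close>. Values at other indices carry no meaning: nothing below constrains or
  reads them.\<close>

type_synonym ('e, 'g) flow = "'e \<Rightarrow> nat \<Rightarrow> nat \<Rightarrow> 'g \<Rightarrow> real"

type_synonym 'e lane_flow = "'e \<Rightarrow> nat \<Rightarrow> nat \<Rightarrow> real"

definition lane_flow_of :: "('i, 'e, 'g) network \<Rightarrow> ('e, 'g) flow \<Rightarrow> 'e lane_flow" where
  "lane_flow_of N y = (\<lambda>e k t. \<Sum>g\<in>groups_on N e. y e k t g)"

definition admissible :: "('i, 'e, 'g) network \<Rightarrow> ('e, 'g) flow set" where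
  "admissible N = {y.
     (\<forall>e\<in>arcs (net N). \<forall>k\<in>lanes. \<forall>t\<in>periods N. \<forall>g\<in>groups_on N e. 0 \<le> y e k t g) \<and>
     (\<forall>i\<in>verts (net N). \<forall>g\<in>groups N. \<forall>t\<in>periods N.
        demand N g * of_bool (i = orig N g)
          + (\<Sum>e\<in>in_arcs (net N) i \<inter> edges_of N g. \<Sum>k\<in>lanes. y e k t g)
        = demand N g * of_bool (i = dest N g)
          + (\<Sum>e\<in>out_arcs (net N) i \<inter> edges_of N g. \<Sum>k\<in>lanes. y e k t g))}"


section \<open>Credit-based congestion pricing\<close>

definition cbcp_feasible ::
  "('i, 'e, 'g) network \<Rightarrow> ('e \<Rightarrow> nat \<Rightarrow> real) \<Rightarrow> ('g \<Rightarrow> real) \<Rightarrow> ('e, 'g) flow set" where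
  "cbcp_feasible N \<tau> B = {y \<in> admissible N.
     \<forall>g\<in>eligible N. (\<Sum>t\<in>periods N. \<Sum>e\<in>edges_of N g. y e 1 t g * \<tau> e t) \<le> B g}"

definition cbcp_cost ::
  "('i, 'e, 'g) network \<Rightarrow> ('e \<Rightarrow> nat \<Rightarrow> real) \<Rightarrow> ('e, 'g) flow \<Rightarrow> 'g \<Rightarrow> 'e \<Rightarrow> nat \<Rightarrow> nat \<Rightarrow> real" where
  "cbcp_cost N \<tau> y g e k t =
     (if k = 1 \<and> g \<in> ineligible N
      then vot N g t * latency N e (lane_flow_of N y e 1 t) + \<tau> e t
      else vot N g t * latency N e (lane_flow_of N y e k t))"

definition cbcp_equilibrium ::
  "('i, 'e, 'g) network \<Rightarrow> real \<Rightarrow> ('e \<Rightarrow> nat \<Rightarrow> real) \<Rightarrow> ('g \<Rightarrow> real) \<Rightarrow> ('e, 'g) flow \<Rightarrow> bool" where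
  "cbcp_equilibrium N \<epsilon> \<tau> B y' \<longleftrightarrow>
     y' \<in> cbcp_feasible N \<tau> B \<and>
     (\<forall>g\<in>groups N. \<forall>y\<in>cbcp_feasible N \<tau> B.
        (\<Sum>e\<in>edges_of N g. \<Sum>k\<in>lanes. \<Sum>t\<in>periods N.
           (y e k t g - y' e k t g) * cbcp_cost N \<tau> y' g e k t) \<ge> - \<epsilon>)"


section \<open>The convex program\<close>

definition program_feasible ::
  "('i, 'e, 'g) network \<Rightarrow> ('e \<Rightarrow> nat \<Rightarrow> real) \<Rightarrow> ('g \<Rightarrow> real) \<Rightarrow>
   (('e, 'g) flow \<times> 'e lane_flow) set" where
  "program_feasible N \<tau> B = {(y, x). y \<in> cbcp_feasible N \<tau> B \<and>
     (\<forall>e\<in>arcs (net N). \<forall>k\<in>lanes. \<forall>t\<in>periods N. x e k t = (\<Sum>g\<in>groups_on N e. y e k t g))}"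

text \<open>On the feasible set the lane flows are nonnegative, so integrating over \<open>{0..x e k t}\<close>
  is the oriented integral from \<open>0\<close> to \<open>x e k t\<close>.\<close>

definition program_objective ::
  "('i, 'e, 'g) network \<Rightarrow> ('e \<Rightarrow> nat \<Rightarrow> real) \<Rightarrow> ('e, 'g) flow \<times> 'e lane_flow \<Rightarrow> real" where
  "program_objective N \<tau> = (\<lambda>(y, x). \<Sum>t\<in>periods N. \<Sum>e\<in>arcs (net N).
     (\<Sum>k\<in>lanes. integral {0..x e k t} (latency N e))
     + (\<Sum>g\<in>groups_on N e \<inter> ineligible N. y e 1 t g * \<tau> e t / vot N g t))"


section \<open>The approximation error\<close>

text \<open>The maxima over eligible groups are of nonnegative quantities; the maximum over an empty
  set of eligible groups is read as \<open>0\<close>. (With no periods, \<open>vot_spread\<close> is unspecified, but it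
  is multiplied by the number of periods in \<open>cbcp_error\<close>.)\<close>

definition max_over :: "'a set \<Rightarrow> ('a \<Rightarrow> real) \<Rightarrow> real" where
  "max_over A f = (if A = {} then 0 else Max (f ` A))"

definition vot_spread :: "('i, 'e, 'g) network \<Rightarrow> real" where
  "vot_spread N =
     1 / 2 * max_over (eligible N) (\<lambda>g. Max (vot N g ` periods N) - Min (vot N g ` periods N))"

definition cbcp_error :: "('i, 'e, 'g) network \<Rightarrow> real" where
  "cbcp_error N = vot_spread N * real (horizon N) *
     max_over (eligible N)
       (\<lambda>g. demand N g * (\<Sum>e\<in>edges_of N g. latency N e (edge_demand N e)))"

end

theory Submission
  imports Defs
begin

text \<open>A flow in which one group deviates stays feasible, because conservation and budgets
  constrain each group separately; so the first-order optimality condition of the convex program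
  holds for each group, with latencies and \<open>\<tau> / v\<close> as prices. An ineligible group
  has no budget and may deviate in one period at a time, so the condition holds period by period
  and can be rescaled by \<open>v\<close>. For an eligible group only the sum over all periods of its
  latency changes \<open>a t\<close> is known to be nonnegative. Weighting by \<open>v t\<close> instead of by the
  midrange of \<open>v\<close> costs at most half the spread of \<open>v\<close> times \<open>\<bar>a t\<bar>\<close> per period, and
  \<open>a t\<close> is a difference of two total latencies that both lie between \<open>0\<close> and the claimed
  bound, since in an acyclic network no edge carries more than the demand of a group.\<close>

section \<open>Edge flows in acyclic networks\<close>

text \<open>A cut argument. Conservation summed over a node set says that outflow minus inflow
  equals what \<open>p\<close> injects minus what \<open>q\<close> absorbs within the set, hence is
  at most \<open>d\<close>. For a set closed under predecessors, this net outflow is at least the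
  flow on any edge that leaves it.\<close>

lemma (in fin_digraph) acyclic_edge_flow_le:
  fixes f :: "'b \<Rightarrow> real"
  assumes acyclic: "\<nexists>c. cycle c"
    and A: "A \<subseteq> arcs G"
    and nonneg: "\<And>e. e \<in> A \<Longrightarrow> 0 \<le> f e"
    and d: "0 \<le> d"
    and conservation: "\<And>i. i \<in> verts G \<Longrightarrow>
      d * of_bool (i = p) + (\<Sum>e\<in>in_arcs G i \<inter> A. f e)
      = d * of_bool (i = q) + (\<Sum>e\<in>out_arcs G i \<inter> A. f e)"
    and e0: "e0 \<in> A"
  shows "f e0 \<le> d"
proof -
  \<comment> \<open>No edge enters the set of nodes from which the tail of \<open>e0\<close> is reachable, and by
    acyclicity \<open>e0\<close> leaves it.\<close>
  define S where "S = {i \<in> verts G. i \<rightarrow>\<^sup>* tail G e0}"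
  have fin: "finite S" "finite A"
    using A finite_subset[OF A] by (auto simp: S_def)
  have "head G e0 \<notin> S"
  proof
    assume "head G e0 \<in> S"
    then obtain r where "awalk (head G e0) r (tail G e0)"
      by (auto simp: S_def reachable_awalk)
    then have "awalk (tail G e0) (e0 # r) (tail G e0)"
      using e0 A by (auto simp: awalk_Cons_iff)
    then have "closed_w (e0 # r)" by (auto simp: closed_w_def)
    then show False using closed_w_imp_cycle acyclic by blast
  qed
  moreover have "tail G e \<in> S" if "e \<in> A" "head G e \<in> S" for e
  proof -
    obtain r where "awalk (head G e) r (tail G e0)"
      using \<open>head G e \<in> S\<close> by (auto simp: S_def reachable_awalk)
    then have "awalk (tail G e) (e # r) (tail G e0)"
      using that A by (auto simp: awalk_Cons_iff)
    then show ?thesis using that A by (auto simp: S_def reachable_awalk)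
  qed
  \<comment> \<open>So every edge counted as inflow is counted as outflow too, and \<open>e0\<close>
    only as outflow.\<close>
  ultimately have sub: "{e \<in> A. head G e \<in> S} \<subseteq> {e \<in> A. tail G e \<in> S} - {e0}"
    by blast
  have inflow: "(\<Sum>i\<in>S. \<Sum>e\<in>in_arcs G i \<inter> A. f e) = (\<Sum>e | e \<in> A \<and> head G e \<in> S. f e)"
  proof -
    have "(\<Sum>i\<in>S. \<Sum>e\<in>in_arcs G i \<inter> A. f e)
        = (\<Sum>i\<in>S. \<Sum>e | e \<in> {e \<in> A. head G e \<in> S} \<and> head G e = i. f e)"
      using A by (intro sum.cong) auto
    also have "\<dots> = (\<Sum>e | e \<in> A \<and> head G e \<in> S. f e)"
      using fin by (intro sum.group) auto
    finally show ?thesis .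
  qed
  have outflow: "(\<Sum>i\<in>S. \<Sum>e\<in>out_arcs G i \<inter> A. f e) = (\<Sum>e | e \<in> A \<and> tail G e \<in> S. f e)"
  proof -
    have "(\<Sum>i\<in>S. \<Sum>e\<in>out_arcs G i \<inter> A. f e)
        = (\<Sum>i\<in>S. \<Sum>e | e \<in> {e \<in> A. tail G e \<in> S} \<and> tail G e = i. f e)"
      using A by (intro sum.cong) auto
    also have "\<dots> = (\<Sum>e | e \<in> A \<and> tail G e \<in> S. f e)"
      using fin by (intro sum.group) auto
    finally show ?thesis .
  qed
  have "(\<Sum>i\<in>S. d * of_bool (i = p) + (\<Sum>e\<in>in_arcs G i \<inter> A. f e))
      = (\<Sum>i\<in>S. d * of_bool (i = q) + (\<Sum>e\<in>out_arcs G i \<inter> A. f e))"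
    by (intro sum.cong conservation) (auto simp: S_def)
  then have balance: "(\<Sum>i\<in>S. d * of_bool (i = p)) + (\<Sum>e | e \<in> A \<and> head G e \<in> S. f e)
      = (\<Sum>i\<in>S. d * of_bool (i = q)) + (\<Sum>e | e \<in> A \<and> tail G e \<in> S. f e)"
    by (simp add: sum.distrib inflow outflow)
  have indicator: "(\<Sum>i\<in>S. d * of_bool (i = x)) = d * of_bool (x \<in> S)" for x
    using fin by (simp add: of_bool_def if_distrib[of "\<lambda>u. d * u"] cong: if_cong)
  have "tail G e0 \<in> S" using e0 A by (auto simp: S_def)
  then have "(\<Sum>e | e \<in> A \<and> tail G e \<in> S. f e)
      = f e0 + (\<Sum>e\<in>{e \<in> A. tail G e \<in> S} - {e0}. f e)"
    using fin e0 by (subst sum.remove[where x = e0]) auto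
  moreover have "(\<Sum>e | e \<in> A \<and> head G e \<in> S. f e)
      \<le> (\<Sum>e\<in>{e \<in> A. tail G e \<in> S} - {e0}. f e)"
    using sub fin nonneg by (intro sum_mono2) auto
  moreover have "d * of_bool (p \<in> S) \<le> d" "0 \<le> d * of_bool (q \<in> S)"
    using d by auto
  ultimately show ?thesis using balance unfolding indicator by linarith
qed

section \<open>One-variable estimates for latencies and weighted sums\<close>

text \<open>Convexity alone settles the interior; only the end point 0 needs an argument. Continuity
  makes the latencies integrable and permits the limit in the optimality condition.\<close>

lemma continuous_on_atLeast_convex_mono:
  fixes l :: "real \<Rightarrow> real"
  assumes "convex_on {0..} l" and "mono_on {0..} l"
  shows "continuous_on {0..} l"
  unfolding continuous_on_eq_continuous_within
proof
  fix x :: real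
  assume "x \<in> {0..}"
  show "continuous (at x within {0..}) l"
  proof (cases "x = 0")
    case True
    \<comment> \<open>A convex function may jump at an end point, but only upwards; monotonicity excludes this.\<close>
    have "(l \<longlongrightarrow> l 0) (at 0 within {0..})"
    proof (rule tendsto_sandwich)
      show "\<forall>\<^sub>F u in at 0 within {0..}. l 0 \<le> l u"
        using assms(2) by (auto simp: eventually_at_filter mono_on_def)
      have "l u \<le> (1 - u) * l 0 + u * l 1" if "0 \<le> u" "u < 1" for u
        using convex_onD[OF assms(1), of u 0 1] that by simp
      then show "\<forall>\<^sub>F u in at 0 within {0..}. l u \<le> (1 - u) * l 0 + u * l 1"
        unfolding eventually_at by (intro exI[of _ 1]) auto
      have "((\<lambda>u. (1 - u) * l 0 + u * l 1) \<longlongrightarrow> (1 - 0) * l 0 + 0 * l 1) (at 0 within {0..})"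
        by (intro tendsto_intros)
      then show "((\<lambda>u. (1 - u) * l 0 + u * l 1) \<longlongrightarrow> l 0) (at 0 within {0..})"
        by simp
    qed simp
    then show ?thesis using True by (simp add: continuous_within)
  next
    case False
    have "continuous_on {0<..} l"
      by (intro convex_on_continuous convex_on_subset[OF assms(1)]) auto
    then show ?thesis
      using False \<open>x \<in> {0..}\<close>
      by (auto simp: continuous_on_eq_continuous_at intro: continuous_at_imp_continuous_within)
  qed
qed

text \<open>The gradient inequality for the convex antiderivative of \<open>l\<close>, with the
  slope taken at the new point \<open>b\<close>. Letting \<open>b\<close> tend to \<open>a\<close>
  then requires only continuity of \<open>l\<close>, and no integral has to be
  differentiated.\<close>

lemma integral_diff_le_mono:
  fixes l :: "real \<Rightarrow> real"
  assumes cont: "continuous_on {0..} l" and mono: "mono_on {0..} l" and "0 \<le> a" "0 \<le> b"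
  shows "integral {0..b} l - integral {0..a} l \<le> (b - a) * l b"
proof -
  have int: "l integrable_on {c..d}" if "0 \<le> c" for c d
    using that by (intro integrable_continuous_interval continuous_on_subset[OF cont]) auto
  show ?thesis
  proof (cases "a \<le> b")
    case True
    have "integral {a..b} l \<le> integral {a..b} (\<lambda>_. l b)"
      using assms by (intro integral_le int) (auto simp: mono_on_def)
    then show ?thesis
      using Henstock_Kurzweil_Integration.integral_combine[OF \<open>0 \<le> a\<close> True int] True by simp
  next
    case False
    have "integral {b..a} (\<lambda>_. l b) \<le> integral {b..a} l"
      using assms by (intro integral_le int) (auto simp: mono_on_def)
    then show ?thesis
      using Henstock_Kurzweil_Integration.integral_combine[of 0 b a l] int[of 0] False \<open>0 \<le> b\<close>
      by (simp add: algebra_simps)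
  qed
qed

text \<open>Split \<open>v t\<close> into a constant \<open>c\<close> and the rest. The constant
  multiplies a nonnegative sum, and the midrange as \<open>c\<close> keeps the rest within half the
  spread, whence the factor 1/2 in \<open>vot_spread\<close>.\<close>

lemma sum_weighted_ge_midrange:
  fixes v a :: "'a \<Rightarrow> real"
  assumes "finite P" and "\<And>t. t \<in> P \<Longrightarrow> m \<le> v t" and "\<And>t. t \<in> P \<Longrightarrow> v t \<le> M"
    and "0 \<le> m" and "m \<le> M" and "\<And>t. t \<in> P \<Longrightarrow> \<bar>a t\<bar> \<le> K" and "0 \<le> (\<Sum>t\<in>P. a t)"
  shows "- ((M - m) / 2 * real (card P) * K) \<le> (\<Sum>t\<in>P. v t * a t)"
proof -
  define c where "c = (M + m) / 2"
  have "- ((M - m) / 2 * K) \<le> (v t - c) * a t" if "t \<in> P" for t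
  proof -
    have "\<bar>v t - c\<bar> \<le> (M - m) / 2"
      unfolding c_def abs_le_iff using assms(2,3)[OF that] by (simp add: field_simps)
    then have "\<bar>v t - c\<bar> * \<bar>a t\<bar> \<le> (M - m) / 2 * K"
      using assms(5) assms(6)[OF that] by (intro mult_mono) auto
    then show ?thesis by (simp add: abs_mult[symmetric] abs_le_iff)
  qed
  then have "(\<Sum>t\<in>P. - ((M - m) / 2 * K)) \<le> (\<Sum>t\<in>P. (v t - c) * a t)"
    by (rule sum_mono)
  moreover have "(\<Sum>t\<in>P. v t * a t) = (\<Sum>t\<in>P. (v t - c) * a t) + c * (\<Sum>t\<in>P. a t)"
    by (simp add: sum_distrib_left sum.distrib[symmetric] algebra_simps)
  moreover have "0 \<le> c * (\<Sum>t\<in>P. a t)"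
    using assms(4,5,7) by (simp add: c_def)
  ultimately show ?thesis by (simp add: mult_ac)
qed

lemma max_over_ge: "finite A \<Longrightarrow> a \<in> A \<Longrightarrow> f a \<le> max_over A f"
  by (auto simp: max_over_def)

lemma max_over_nonneg: "finite A \<Longrightarrow> (\<And>a. a \<in> A \<Longrightarrow> 0 \<le> f a) \<Longrightarrow> 0 \<le> max_over A f"
  by (metis all_not_in_conv max_over_def max_over_ge order_refl order_trans)

section \<open>Bounds on flows and latencies\<close>

context cbcp_network
begin

lemma latency_mono: "e \<in> arcs (net N) \<Longrightarrow> mono_on {0..} (latency N e)"
  using latency_strict_mono by (rule strict_mono_on_imp_mono_on)

lemma latency_continuous: "e \<in> arcs (net N) \<Longrightarrow> continuous_on {0..} (latency N e)"
  using latency_convex latency_mono by (rule continuous_on_atLeast_convex_mono)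

lemma finite_arcs: "finite (arcs (net N))"
  by (rule fin_digraph.finite_arcs[OF finite_digraph])

lemma groups_on_subset: "groups_on N e \<subseteq> groups N"
  by (auto simp: groups_on_def)

lemma finite_groups_on: "finite (groups_on N e)"
  using groups_on_subset finite_groups by (rule finite_subset)

lemma finite_eligible: "finite (eligible N)"
  using finite_groups by (simp add: groups_def)

text \<open>Conservation sees only the sum over both lanes, so the cut bound is applied to that sum
  on the subgraph \<open>edges_of N g\<close>.\<close>

lemma edge_flow_le_demand:
  assumes y: "y \<in> admissible N" and g: "g \<in> groups N" and t: "t \<in> periods N"
    and e: "e \<in> edges_of N g"
  shows "(\<Sum>k\<in>lanes. y e k t g) \<le> demand N g"
proof (rule fin_digraph.acyclic_edge_flow_le[OF finite_digraph acyclic, where A = "edges_of N g"])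
  show "edges_of N g \<subseteq> arcs (net N)" by (auto simp: edges_of_def)
  show "0 \<le> (\<Sum>k\<in>lanes. y e' k t g)" if "e' \<in> edges_of N g" for e'
    using y that t by (intro sum_nonneg) (auto simp: admissible_def edges_of_def)
  show "demand N g * of_bool (i = orig N g)
        + (\<Sum>e\<in>in_arcs (net N) i \<inter> edges_of N g. \<Sum>k\<in>lanes. y e k t g)
      = demand N g * of_bool (i = dest N g)
        + (\<Sum>e\<in>out_arcs (net N) i \<inter> edges_of N g. \<Sum>k\<in>lanes. y e k t g)"
    if "i \<in> verts (net N)" for i
    using y g t that by (simp add: admissible_def)
qed (use demand_nonneg g e in auto)

lemma lane_flow_nonneg:
  assumes "y \<in> admissible N" "e \<in> arcs (net N)" "k \<in> lanes" "t \<in> periods N"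
  shows "0 \<le> lane_flow_of N y e k t"
  using assms by (auto simp: admissible_def lane_flow_of_def intro!: sum_nonneg)

lemma lane_flow_le_edge_demand:
  assumes y: "y \<in> admissible N" and e: "e \<in> arcs (net N)" and k: "k \<in> lanes"
    and t: "t \<in> periods N"
  shows "lane_flow_of N y e k t \<le> edge_demand N e"
  unfolding lane_flow_of_def edge_demand_def
proof (rule sum_mono)
  fix g assume g: "g \<in> groups_on N e"
  have "y e k t g \<le> (\<Sum>k\<in>lanes. y e k t g)"
    using y e k t g by (intro member_le_sum) (auto simp: admissible_def lanes_def)
  also have "\<dots> \<le> demand N g"
    using y t g e groups_on_subset by (intro edge_flow_le_demand) (auto simp: edges_of_def)
  finally show "y e k t g \<le> demand N g" .
qed

lemma edge_demand_nonneg: "0 \<le> edge_demand N e"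
  unfolding edge_demand_def using demand_nonneg groups_on_subset by (intro sum_nonneg) auto

text \<open>Quantities and prices come from different flows: \<open>y\<close> is the minimizer or a
  deviation from it, while \<open>y'\<close> sets the latencies. Both lanes share the latency bound
  at \<open>edge_demand\<close>, and the demand bounds the two lanes jointly, so no factor 2
  arises.\<close>

lemma group_latency_bounds:
  assumes y: "y \<in> admissible N" and y': "y' \<in> admissible N"
    and g: "g \<in> groups N" and t: "t \<in> periods N"
  defines "c \<equiv> (\<Sum>e\<in>edges_of N g. \<Sum>k\<in>lanes. y e k t g * latency N e (lane_flow_of N y' e k t))"
  shows "0 \<le> c"
    and "c \<le> demand N g * (\<Sum>e\<in>edges_of N g. latency N e (edge_demand N e))"
proof -
  have y_nonneg: "0 \<le> y e k t g" if "e \<in> edges_of N g" "k \<in> lanes" for e k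
    using y that t by (auto simp: admissible_def edges_of_def)
  have latency: "0 \<le> latency N e (lane_flow_of N y' e k t)"
      "latency N e (lane_flow_of N y' e k t) \<le> latency N e (edge_demand N e)"
    if "e \<in> edges_of N g" "k \<in> lanes" for e k
  proof -
    have e: "e \<in> arcs (net N)" using that by (auto simp: edges_of_def)
    show "0 \<le> latency N e (lane_flow_of N y' e k t)"
      using e that y' t by (intro latency_nonneg lane_flow_nonneg)
    show "latency N e (lane_flow_of N y' e k t) \<le> latency N e (edge_demand N e)"
      using e that y' t edge_demand_nonneg
      by (intro mono_onD[OF latency_mono] lane_flow_le_edge_demand) (auto intro: lane_flow_nonneg)
  qed
  show "0 \<le> c"
    unfolding c_def using y_nonneg latency by (intro sum_nonneg mult_nonneg_nonneg)
  have "(\<Sum>k\<in>lanes. y e k t g * latency N e (lane_flow_of N y' e k t))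
      \<le> demand N g * latency N e (edge_demand N e)" if e: "e \<in> edges_of N g" for e
  proof -
    have "(\<Sum>k\<in>lanes. y e k t g * latency N e (lane_flow_of N y' e k t))
        \<le> (\<Sum>k\<in>lanes. y e k t g * latency N e (edge_demand N e))"
      using e y_nonneg latency by (intro sum_mono mult_left_mono)
    also have "\<dots> = (\<Sum>k\<in>lanes. y e k t g) * latency N e (edge_demand N e)"
      by (rule sum_distrib_right[symmetric])
    also have "\<dots> \<le> demand N g * latency N e (edge_demand N e)"
      using e y g t edge_demand_nonneg
      by (intro mult_right_mono edge_flow_le_demand latency_nonneg) (auto simp: edges_of_def)
    finally show ?thesis .
  qed
  then show "c \<le> demand N g * (\<Sum>e\<in>edges_of N g. latency N e (edge_demand N e))"
    unfolding c_def sum_distrib_left by (rule sum_mono)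
qed

section \<open>First-order optimality for the convex program\<close>

lemma cbcp_feasible_convex:
  assumes y: "y \<in> cbcp_feasible N \<tau> B" and z: "z \<in> cbcp_feasible N \<tau> B"
    and s: "0 \<le> s" "s \<le> (1::real)"
  shows "(\<lambda>e k t g. (1 - s) * y e k t g + s * z e k t g) \<in> cbcp_feasible N \<tau> B"
proof -
  have split: "(\<Sum>e\<in>A. \<Sum>k\<in>lanes. (1 - s) * y e k t g + s * z e k t g)
      = (1 - s) * (\<Sum>e\<in>A. \<Sum>k\<in>lanes. y e k t g) + s * (\<Sum>e\<in>A. \<Sum>k\<in>lanes. z e k t g)" for A t g
    by (simp add: sum.distrib sum_distrib_left)
  \<comment> \<open>The demand terms stay fixed instead of being scaled; they are recovered because
    the weights add up to 1.\<close>
  have combine: "D + ((1 - s) * a + s * b) = D' + ((1 - s) * a' + s * b')"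
    if "D + a = D' + a'" "D + b = D' + b'" for D D' a a' b b' :: real
  proof -
    have "D + ((1 - s) * a + s * b) = (1 - s) * (D + a) + s * (D + b)"
      by (simp add: algebra_simps)
    also have "\<dots> = D' + ((1 - s) * a' + s * b')"
      unfolding that by (simp add: algebra_simps)
    finally show ?thesis .
  qed
  have "(\<Sum>t\<in>periods N. \<Sum>e\<in>edges_of N g. ((1 - s) * y e 1 t g + s * z e 1 t g) * \<tau> e t) \<le> B g"
    if "g \<in> eligible N" for g
  proof -
    have "(\<Sum>t\<in>periods N. \<Sum>e\<in>edges_of N g. ((1 - s) * y e 1 t g + s * z e 1 t g) * \<tau> e t)
      = (1 - s) * (\<Sum>t\<in>periods N. \<Sum>e\<in>edges_of N g. y e 1 t g * \<tau> e t)
        + s * (\<Sum>t\<in>periods N. \<Sum>e\<in>edges_of N g. z e 1 t g * \<tau> e t)"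
      by (simp add: sum.distrib sum_distrib_left distrib_right mult.assoc)
    also have "\<dots> \<le> B g"
      using y z s that by (intro convex_bound_le) (auto simp: cbcp_feasible_def)
    finally show ?thesis .
  qed
  moreover have "(\<lambda>e k t g. (1 - s) * y e k t g + s * z e k t g) \<in> admissible N"
    unfolding admissible_def mem_Collect_eq split
    using y z s by (intro conjI ballI combine) (auto simp: cbcp_feasible_def admissible_def)
  ultimately show ?thesis by (simp add: cbcp_feasible_def)
qed

text \<open>Move from \<open>y'\<close> towards \<open>z\<close> along the segment
  \<open>w s\<close>. The objective cannot fall, yet by the gradient inequality it rises by at most
  \<open>s * F s\<close>, where \<open>F\<close> prices the direction at the latencies of the moved
  point. Hence \<open>F s\<close> is nonnegative for small positive \<open>s\<close>, and its limit
  \<open>F 0\<close> is the claim.\<close>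

lemma minimizer_variational_inequality:
  assumes min: "is_arg_min (program_objective N \<tau>) (\<lambda>z. z \<in> program_feasible N \<tau> B)
      (y', lane_flow_of N y')"
    and z: "z \<in> cbcp_feasible N \<tau> B"
  shows "0 \<le> (\<Sum>t\<in>periods N. \<Sum>e\<in>arcs (net N).
      (\<Sum>k\<in>lanes. (lane_flow_of N z e k t - lane_flow_of N y' e k t)
        * latency N e (lane_flow_of N y' e k t))
      + (\<Sum>g\<in>groups_on N e \<inter> ineligible N. (z e 1 t g - y' e 1 t g) * \<tau> e t / vot N g t))"
proof -
  define X where "X = lane_flow_of N y'"
  define D where "D e k t = lane_flow_of N z e k t - X e k t" for e k t
  define R where "R e t = (\<Sum>g\<in>groups_on N e \<inter> ineligible N.
    (z e 1 t g - y' e 1 t g) * \<tau> e t / vot N g t)" for e t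
  define F where "F s = (\<Sum>t\<in>periods N. \<Sum>e\<in>arcs (net N).
    (\<Sum>k\<in>lanes. D e k t * latency N e (X e k t + s * D e k t)) + R e t)" for s
  define w where "w s = (\<lambda>e k t g. (1 - s) * y' e k t g + s * z e k t g)" for s :: real
  have y': "y' \<in> cbcp_feasible N \<tau> B"
    using min by (simp add: is_arg_min_def program_feasible_def)
  have lane_w: "lane_flow_of N (w s) e k t = X e k t + s * D e k t" for s e k t
    by (simp add: lane_flow_of_def w_def X_def D_def sum.distrib sum_distrib_left[symmetric]
      algebra_simps sum_subtractf)
  have w: "w s \<in> cbcp_feasible N \<tau> B" if "0 \<le> s" "s \<le> 1" for s
    unfolding w_def using y' z that by (rule cbcp_feasible_convex)
  \<comment> \<open>Latencies are monotone and continuous only on the nonnegative half-line, so the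
    whole segment must stay there.\<close>
  have w_nonneg: "0 \<le> X e k t + s * D e k t"
    if "0 \<le> s" "s \<le> 1" "e \<in> arcs (net N)" "k \<in> lanes" "t \<in> periods N" for s e k t
    unfolding lane_w[symmetric] using that w by (intro lane_flow_nonneg) (auto simp: cbcp_feasible_def)
  have F_nonneg: "0 \<le> F s" if s: "0 < s" "s < 1" for s
  proof -
    have "(w s, lane_flow_of N (w s)) \<in> program_feasible N \<tau> B"
      using w s by (auto simp: program_feasible_def lane_flow_of_def)
    then have "program_objective N \<tau> (y', X) \<le> program_objective N \<tau> (w s, lane_flow_of N (w s))"
      using min by (auto simp: is_arg_min_linorder X_def)
    then have "0 \<le> (\<Sum>t\<in>periods N. \<Sum>e\<in>arcs (net N).
        (\<Sum>k\<in>lanes. integral {0..X e k t + s * D e k t} (latency N e)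
           - integral {0..X e k t} (latency N e))
        + (\<Sum>g\<in>groups_on N e \<inter> ineligible N. w s e 1 t g * \<tau> e t / vot N g t
           - y' e 1 t g * \<tau> e t / vot N g t))"
      by (simp add: program_objective_def lane_w sum.distrib sum_subtractf)
    also have "\<dots> \<le> (\<Sum>t\<in>periods N. \<Sum>e\<in>arcs (net N).
        (\<Sum>k\<in>lanes. s * (D e k t * latency N e (X e k t + s * D e k t))) + s * R e t)"
    proof (intro sum_mono add_mono)
      fix t e k
      assume *: "t \<in> periods N" "e \<in> arcs (net N)" "k \<in> lanes"
      show "integral {0..X e k t + s * D e k t} (latency N e) - integral {0..X e k t} (latency N e)
          \<le> s * (D e k t * latency N e (X e k t + s * D e k t))"
        using integral_diff_le_mono[OF latency_continuous latency_mono, of e "X e k t"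
            "X e k t + s * D e k t"] * s w_nonneg[of s e k t] w_nonneg[of 0 e k t]
        by simp
    next
      fix t e
      have "(\<Sum>g\<in>groups_on N e \<inter> ineligible N. w s e 1 t g * \<tau> e t / vot N g t
           - y' e 1 t g * \<tau> e t / vot N g t) = s * R e t"
        unfolding R_def sum_distrib_left w_def
        by (intro sum.cong) (auto simp: algebra_simps add_divide_distrib diff_divide_distrib)
      then show "(\<Sum>g\<in>groups_on N e \<inter> ineligible N. w s e 1 t g * \<tau> e t / vot N g t
           - y' e 1 t g * \<tau> e t / vot N g t) \<le> s * R e t" by simp
    qed
    also have "\<dots> = s * F s"
      by (simp add: F_def sum_distrib_left distrib_left)
    finally show ?thesis using s by (simp add: zero_le_mult_iff)
  qed
  \<comment> \<open>Only a one-sided limit is available: for \<open>s\<close> outside the unit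
    interval the lane flows may be negative.\<close>
  have "(F \<longlongrightarrow> F 0) (at 0 within {0..1})"
    unfolding F_def
  proof (intro tendsto_sum tendsto_add tendsto_mult tendsto_const)
    fix t e k
    assume *: "t \<in> periods N" "e \<in> arcs (net N)" "k \<in> lanes"
    have cont: "continuous_on {0..1} (\<lambda>s. latency N e (X e k t + s * D e k t))"
      using * w_nonneg
      by (intro continuous_on_compose2[OF latency_continuous] continuous_intros) auto
    show "((\<lambda>s. latency N e (X e k t + s * D e k t))
        \<longlongrightarrow> latency N e (X e k t + 0 * D e k t)) (at 0 within {0..1})"
      by (rule cont[unfolded continuous_on_def, THEN bspec, of 0]) simp
  qed
  then have "(F \<longlongrightarrow> F 0) (at_right 0)"
    by (simp add: at_within_Icc_at_right)
  moreover have "\<forall>\<^sub>F s in at_right 0. 0 \<le> F s"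
    using eventually_at_right_real[of 0 1] F_nonneg by (auto elim!: eventually_mono)
  ultimately have "0 \<le> F 0"
    by (intro tendsto_lowerbound) auto
  then show ?thesis by (simp add: F_def D_def R_def X_def)
qed

section \<open>Deviations of a single group\<close>

text \<open>Conservation also separates the periods, so components may be exchanged for any set
  \<open>Q\<close> of periods. A budget couples all periods of an eligible group, which must
  therefore switch in all of them at once.\<close>

lemma group_deviation_feasible:
  assumes y': "y' \<in> cbcp_feasible N \<tau> B" and y: "y \<in> cbcp_feasible N \<tau> B"
    and Q: "g \<in> eligible N \<Longrightarrow> Q = periods N"
  shows "(\<lambda>e k t h. if h = g \<and> t \<in> Q then y e k t h else y' e k t h) \<in> cbcp_feasible N \<tau> B"
    (is "?z \<in> _")
proof -
  have "?z \<in> admissible N"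
  proof -
    have split: "(\<Sum>e\<in>A. \<Sum>k\<in>lanes. ?z e k t h)
        = (if h = g \<and> t \<in> Q then \<Sum>e\<in>A. \<Sum>k\<in>lanes. y e k t h
           else \<Sum>e\<in>A. \<Sum>k\<in>lanes. y' e k t h)" for A t h
      by auto
    have select: "D + (if P then a else b) = D' + (if P then a' else b')"
      if "D + a = D' + a'" "D + b = D' + b'" for P and D D' a a' b b' :: real
      using that by simp
    show ?thesis
      unfolding admissible_def mem_Collect_eq split
      using y y' by (intro conjI ballI select) (auto simp: cbcp_feasible_def admissible_def)
  qed
  moreover have "(\<Sum>t\<in>periods N. \<Sum>e\<in>edges_of N h. ?z e 1 t h * \<tau> e t) \<le> B h"
    if h: "h \<in> eligible N" for h
  proof (cases "h = g")
    case True
    then show ?thesis using y Q h by (simp add: cbcp_feasible_def)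
  next
    case False
    then show ?thesis using y' h by (simp add: cbcp_feasible_def)
  qed
  ultimately show ?thesis unfolding cbcp_feasible_def by blast
qed

text \<open>Testing optimality with a flow that differs from \<open>y'\<close> only for
  \<open>g\<close> and only during \<open>Q\<close> cancels all other terms. A variable
  \<open>Q\<close> serves both kinds of groups: single periods for ineligible ones, all periods for
  eligible ones.\<close>

lemma group_variational_inequality:
  assumes min: "is_arg_min (program_objective N \<tau>) (\<lambda>z. z \<in> program_feasible N \<tau> B)
      (y', lane_flow_of N y')"
    and y: "y \<in> cbcp_feasible N \<tau> B"
    and Q: "Q \<subseteq> periods N" "g \<in> eligible N \<Longrightarrow> Q = periods N"
  shows "0 \<le> (\<Sum>t\<in>Q. \<Sum>e\<in>edges_of N g.
      (\<Sum>k\<in>lanes. (y e k t g - y' e k t g) * latency N e (lane_flow_of N y' e k t))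
      + of_bool (g \<in> ineligible N) * ((y e 1 t g - y' e 1 t g) * \<tau> e t / vot N g t))"
proof -
  define z where "z = (\<lambda>e k t h. if h = g \<and> t \<in> Q then y e k t h else y' e k t h)"
  define L where "L e t = (\<Sum>k\<in>lanes. (y e k t g - y' e k t g)
    * latency N e (lane_flow_of N y' e k t))" for e t
  define R where "R e t = of_bool (g \<in> ineligible N)
    * ((y e 1 t g - y' e 1 t g) * \<tau> e t / vot N g t)" for e t
  have y': "y' \<in> cbcp_feasible N \<tau> B"
    using min by (simp add: is_arg_min_def program_feasible_def)
  have lane: "lane_flow_of N z e k t - lane_flow_of N y' e k t
      = (if t \<in> Q \<and> g \<in> groups_on N e then y e k t g - y' e k t g else 0)" for e k t
  proof -
    have "lane_flow_of N z e k t - lane_flow_of N y' e k t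
        = (\<Sum>h\<in>groups_on N e. if h = g then of_bool (t \<in> Q) * (y e k t g - y' e k t g) else 0)"
      unfolding lane_flow_of_def sum_subtractf[symmetric]
      by (intro sum.cong) (auto simp: z_def)
    then show ?thesis using finite_groups_on by simp
  qed
  have toll: "(\<Sum>h\<in>groups_on N e \<inter> ineligible N. (z e 1 t h - y' e 1 t h) * \<tau> e t / vot N h t)
      = (if t \<in> Q \<and> g \<in> groups_on N e then R e t else 0)" for e t
  proof -
    have "(\<Sum>h\<in>groups_on N e \<inter> ineligible N. (z e 1 t h - y' e 1 t h) * \<tau> e t / vot N h t)
        = (\<Sum>h\<in>groups_on N e \<inter> ineligible N. if h = g then of_bool (t \<in> Q) * R e t else 0)"
      by (intro sum.cong) (auto simp: z_def R_def)
    then show ?thesis using finite_groups_on by (simp add: R_def)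
  qed
  have "z \<in> cbcp_feasible N \<tau> B"
    unfolding z_def using y' y Q(2) by (rule group_deviation_feasible)
  then have "0 \<le> (\<Sum>t\<in>periods N. \<Sum>e\<in>arcs (net N).
      (\<Sum>k\<in>lanes. (lane_flow_of N z e k t - lane_flow_of N y' e k t)
        * latency N e (lane_flow_of N y' e k t))
      + (\<Sum>h\<in>groups_on N e \<inter> ineligible N. (z e 1 t h - y' e 1 t h) * \<tau> e t / vot N h t))"
    by (rule minimizer_variational_inequality[OF min])
  also have "\<dots> = (\<Sum>t\<in>periods N. \<Sum>e\<in>arcs (net N).
      if t \<in> Q \<and> g \<in> groups_on N e then L e t + R e t else 0)"
    unfolding lane toll by (intro sum.cong) (auto simp: L_def)
  also have "\<dots> = (\<Sum>t\<in>periods N. if t \<in> Q then \<Sum>e\<in>edges_of N g. L e t + R e t else 0)"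
    using finite_arcs by (intro sum.cong) (auto simp: edges_of_def sum.inter_filter)
  also have "\<dots> = (\<Sum>t\<in>Q. \<Sum>e\<in>edges_of N g. L e t + R e t)"
    using Q(1) by (simp add: sum.inter_restrict[symmetric] periods_def Int_absorb1)
  finally show ?thesis by (simp add: L_def R_def)
qed

section \<open>The error term\<close>

lemma vot_range_nonneg:
  assumes "periods N \<noteq> {}"
  shows "0 \<le> Max (vot N g ` periods N) - Min (vot N g ` periods N)"
proof -
  obtain t where "t \<in> periods N" using assms by auto
  then have "Min (vot N g ` periods N) \<le> vot N g t" "vot N g t \<le> Max (vot N g ` periods N)"
    by (auto simp: periods_def)
  then show ?thesis by linarith
qed

lemma latency_bound_nonneg:
  assumes "g \<in> groups N"
  shows "0 \<le> demand N g * (\<Sum>e\<in>edges_of N g. latency N e (edge_demand N e))"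
  using assms demand_nonneg edge_demand_nonneg latency_nonneg
  by (intro mult_nonneg_nonneg sum_nonneg) (auto simp: edges_of_def)

text \<open>The two maxima in \<open>cbcp_error\<close> may be attained by different groups. Since
  both factors are nonnegative, the product of the maxima still dominates the product for each
  single group.\<close>

lemma cbcp_error_ge:
  assumes "g \<in> eligible N" "periods N \<noteq> {}"
  shows "(Max (vot N g ` periods N) - Min (vot N g ` periods N)) / 2 * real (card (periods N))
      * (demand N g * (\<Sum>e\<in>edges_of N g. latency N e (edge_demand N e))) \<le> cbcp_error N"
proof -
  have "(Max (vot N g ` periods N) - Min (vot N g ` periods N)) / 2 \<le> vot_spread N"
    using max_over_ge[OF finite_eligible assms(1),
        of "\<lambda>g. Max (vot N g ` periods N) - Min (vot N g ` periods N)"]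
    by (simp add: vot_spread_def)
  moreover have "demand N g * (\<Sum>e\<in>edges_of N g. latency N e (edge_demand N e))
      \<le> max_over (eligible N) (\<lambda>g. demand N g * (\<Sum>e\<in>edges_of N g. latency N e (edge_demand N e)))"
    by (rule max_over_ge[OF finite_eligible assms(1)])
  moreover have "0 \<le> (Max (vot N g ` periods N) - Min (vot N g ` periods N)) / 2"
    using vot_range_nonneg[OF assms(2)] by simp
  moreover have "0 \<le> demand N g * (\<Sum>e\<in>edges_of N g. latency N e (edge_demand N e))"
    using assms(1) by (intro latency_bound_nonneg) (simp add: groups_def)
  ultimately show ?thesis
    unfolding cbcp_error_def
    by (intro mult_mono) (auto simp: periods_def intro: order_trans)
qed

text \<open>Turns the exact inequality for ineligible groups into one with slack
  \<open>cbcp_error N\<close>.\<close>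

lemma cbcp_error_nonneg: "0 \<le> cbcp_error N"
proof (cases "periods N = {}")
  \<comment> \<open>Here \<open>vot_spread N\<close> is an unspecified value, but it is multiplied
    by \<open>horizon N\<close>, which is 0.\<close>
  case True
  then have "horizon N = 0" by (simp add: periods_def)
  then show ?thesis by (simp add: cbcp_error_def)
next
  case False
  have "0 \<le> vot_spread N"
    using max_over_nonneg[OF finite_eligible] vot_range_nonneg[OF False] by (simp add: vot_spread_def)
  moreover have "0 \<le> max_over (eligible N)
      (\<lambda>g. demand N g * (\<Sum>e\<in>edges_of N g. latency N e (edge_demand N e)))"
    using latency_bound_nonneg by (intro max_over_nonneg[OF finite_eligible]) (auto simp: groups_def)
  ultimately show ?thesis by (simp add: cbcp_error_def)
qed

section \<open>Cost changes of ineligible and eligible groups\<close>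

text \<open>Within one period \<open>vot N g t\<close> is a positive constant; multiplying by it
  turns the price \<open>\<tau> e t / vot N g t\<close> of the program into the toll that the group
  pays. Nothing is lost, so no error term appears.\<close>

lemma minimizer_ineligible_cost_ge:
  assumes min: "is_arg_min (program_objective N \<tau>) (\<lambda>z. z \<in> program_feasible N \<tau> B)
      (y', lane_flow_of N y')"
    and y: "y \<in> cbcp_feasible N \<tau> B" and g: "g \<in> ineligible N"
  shows "0 \<le> (\<Sum>e\<in>edges_of N g. \<Sum>k\<in>lanes. \<Sum>t\<in>periods N.
      (y e k t g - y' e k t g) * cbcp_cost N \<tau> y' g e k t)"
proof -
  have "g \<notin> eligible N" using g eligibility_disjoint by auto
  have vot: "0 < vot N g t" if "t \<in> periods N" for t
    using that g by (intro vot_pos) (simp_all add: groups_def)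
  have "0 \<le> vot N g t * (\<Sum>e\<in>edges_of N g.
      (\<Sum>k\<in>lanes. (y e k t g - y' e k t g) * latency N e (lane_flow_of N y' e k t))
      + (y e 1 t g - y' e 1 t g) * \<tau> e t / vot N g t)" if "t \<in> periods N" for t
    using group_variational_inequality[OF min y, of "{t}" g] that g \<open>g \<notin> eligible N\<close> vot[OF that]
    by (intro mult_nonneg_nonneg) auto
  then have "0 \<le> (\<Sum>t\<in>periods N. vot N g t * (\<Sum>e\<in>edges_of N g.
      (\<Sum>k\<in>lanes. (y e k t g - y' e k t g) * latency N e (lane_flow_of N y' e k t))
      + (y e 1 t g - y' e 1 t g) * \<tau> e t / vot N g t))"
    by (rule sum_nonneg)
  also have "\<dots> = (\<Sum>t\<in>periods N. \<Sum>e\<in>edges_of N g. \<Sum>k\<in>lanes.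
      (y e k t g - y' e k t g) * cbcp_cost N \<tau> y' g e k t)"
    unfolding sum_distrib_left
  proof (intro sum.cong refl)
    fix t e assume "t \<in> periods N"
    then show "vot N g t * ((\<Sum>k\<in>lanes. (y e k t g - y' e k t g)
          * latency N e (lane_flow_of N y' e k t)) + (y e 1 t g - y' e 1 t g) * \<tau> e t / vot N g t)
        = (\<Sum>k\<in>lanes. (y e k t g - y' e k t g) * cbcp_cost N \<tau> y' g e k t)"
      using g vot[of t] by (simp add: lanes_def cbcp_cost_def field_simps)
  qed
  also have "\<dots> = (\<Sum>e\<in>edges_of N g. \<Sum>k\<in>lanes. \<Sum>t\<in>periods N.
      (y e k t g - y' e k t g) * cbcp_cost N \<tau> y' g e k t)"
    by (subst sum.swap) (intro sum.cong refl sum.swap)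
  finally show ?thesis .
qed

text \<open>An eligible group has a toll term neither in its cost nor in the objective. Its cost
  change is thus the sum of \<open>vot N g t * a t\<close>, whereas optimality controls only the
  unweighted sum of \<open>a t\<close>; the midrange estimate bridges the two.\<close>

lemma minimizer_eligible_cost_ge:
  assumes min: "is_arg_min (program_objective N \<tau>) (\<lambda>z. z \<in> program_feasible N \<tau> B)
      (y', lane_flow_of N y')"
    and y: "y \<in> cbcp_feasible N \<tau> B" and g: "g \<in> eligible N"
  shows "- cbcp_error N \<le> (\<Sum>e\<in>edges_of N g. \<Sum>k\<in>lanes. \<Sum>t\<in>periods N.
      (y e k t g - y' e k t g) * cbcp_cost N \<tau> y' g e k t)"
proof (cases "periods N = {}")
  \<comment> \<open>Without periods the cost change is an empty sum, and \<open>Min\<close> and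
    \<open>Max\<close> of the values of time would be unspecified.\<close>
  case True
  then show ?thesis using cbcp_error_nonneg by simp
next
  case False
  define c where "c y t = (\<Sum>e\<in>edges_of N g. \<Sum>k\<in>lanes.
    y e k t g * latency N e (lane_flow_of N y' e k t))" for y :: "('e, 'g) flow" and t
  define a where "a t = c y t - c y' t" for t
  define K where "K = demand N g * (\<Sum>e\<in>edges_of N g. latency N e (edge_demand N e))"
  define m where "m = Min (vot N g ` periods N)"
  define M where "M = Max (vot N g ` periods N)"
  have "g \<notin> ineligible N" using g eligibility_disjoint by auto
  have gN: "g \<in> groups N" using g by (simp add: groups_def)
  have fin: "finite (periods N)" by (simp add: periods_def)
  have y': "y' \<in> cbcp_feasible N \<tau> B"
    using min by (simp add: is_arg_min_def program_feasible_def)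
  have a_eq: "a t = (\<Sum>e\<in>edges_of N g. \<Sum>k\<in>lanes. (y e k t g - y' e k t g)
      * latency N e (lane_flow_of N y' e k t))" for t
    by (simp add: a_def c_def sum_subtractf left_diff_distrib)
  have "- ((M - m) / 2 * real (card (periods N)) * K) \<le> (\<Sum>t\<in>periods N. vot N g t * a t)"
  proof (rule sum_weighted_ge_midrange[OF fin])
    show "m \<le> vot N g t" "vot N g t \<le> M" if "t \<in> periods N" for t
      using that fin by (simp_all add: m_def M_def)
    have "m \<in> vot N g ` periods N"
      unfolding m_def using fin False by (intro Min_in) auto
    then show "0 \<le> m" using vot_pos[OF gN] by (auto intro: less_imp_le)
    show "m \<le> M" using vot_range_nonneg[OF False, of g] by (simp add: m_def M_def)
    show "\<bar>a t\<bar> \<le> K" if "t \<in> periods N" for t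
    proof -
      have "0 \<le> c y t" "c y t \<le> K" "0 \<le> c y' t" "c y' t \<le> K"
        using y y' gN that unfolding c_def K_def
        by (auto simp: cbcp_feasible_def intro!: group_latency_bounds)
      then show ?thesis by (simp add: a_def abs_le_iff)
    qed
    show "0 \<le> (\<Sum>t\<in>periods N. a t)"
      using group_variational_inequality[OF min y, of "periods N" g] \<open>g \<notin> ineligible N\<close>
      by (simp add: a_eq)
  qed
  moreover have "(M - m) / 2 * real (card (periods N)) * K \<le> cbcp_error N"
    unfolding M_def m_def K_def using g False by (rule cbcp_error_ge)
  moreover have "(\<Sum>t\<in>periods N. vot N g t * a t)
      = (\<Sum>t\<in>periods N. \<Sum>e\<in>edges_of N g. \<Sum>k\<in>lanes.
          (y e k t g - y' e k t g) * cbcp_cost N \<tau> y' g e k t)"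
    using \<open>g \<notin> ineligible N\<close> by (simp add: a_eq sum_distrib_left cbcp_cost_def mult_ac)
  moreover have "\<dots> = (\<Sum>e\<in>edges_of N g. \<Sum>k\<in>lanes. \<Sum>t\<in>periods N.
      (y e k t g - y' e k t g) * cbcp_cost N \<tau> y' g e k t)"
    by (subst sum.swap) (intro sum.cong refl sum.swap)
  ultimately show ?thesis by linarith
qed

end

theorem proposition4p6:
  fixes N :: "('i, 'e, 'g) network"
    and \<tau> :: "'e \<Rightarrow> nat \<Rightarrow> real"
    and B :: "'g \<Rightarrow> real"
    and y' :: "('e, 'g) flow"
  assumes "cbcp_network N"
    and "\<And>e t. e \<in> arcs (net N) \<Longrightarrow> t \<in> periods N \<Longrightarrow> 0 \<le> \<tau> e t"
    and "\<And>g. g \<in> eligible N \<Longrightarrow> 0 \<le> B g"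
    and "y' \<in> cbcp_feasible N \<tau> B"
    and "is_arg_min (program_objective N \<tau>) (\<lambda>z. z \<in> program_feasible N \<tau> B)
           (y', lane_flow_of N y')"
  shows "cbcp_equilibrium N (cbcp_error N) \<tau> B y'"
proof -
  interpret cbcp_network N by (rule assms(1))
  have "- cbcp_error N \<le> (\<Sum>e\<in>edges_of N g. \<Sum>k\<in>lanes. \<Sum>t\<in>periods N.
      (y e k t g - y' e k t g) * cbcp_cost N \<tau> y' g e k t)"
    if "g \<in> groups N" "y \<in> cbcp_feasible N \<tau> B" for g y
    using that minimizer_eligible_cost_ge[OF assms(5)] minimizer_ineligible_cost_ge[OF assms(5)]
      cbcp_error_nonneg
    by (fastforce simp: groups_def)
  then show ?thesis using assms(4) by (simp add: cbcp_equilibrium_def)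
qed

end
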